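(* Let $\underline{\mathsf{Cyl}}=(\mathsf{Cyl},i_0,i_1,p,v,\mathsf S,r_0,r_1,s,\Gamma_{lr},\Gamma_{ur})$ be a cylinder in a formal category $\mathcal A$ equipped with a contraction structure $p$, an involution structure $v$, a subdivision structure $(\mathsf S,r_0,r_1,s)$ compatible with $p$, a lower right connection structure $\Gamma_{lr}$, and an upper right connection structure $\Gamma_{ur}$. Suppose that $\Gamma_{lr}$ and $\Gamma_{ur}$ are compatible with the subdivision structure $(\mathsf S,r_0,r_1,s)$, and that $\mathsf{Cyl}$ preserves mapping cylinders with respect to $\underline{\mathsf{Cyl}}$. Let $j:a_0\to a_1$ be an arrow of $\mathcal A$ which is a cofibration with respect to $\underline{\mathsf{Cyl}}$, and suppose that $(a_j,d^0_j,d^1_j)$ is a mapping cylinder of $j$ with respect to $\underline{\mathsf{Cyl}}$. Let $m_j:a_j\to\mathsf{Cyl}(a_1)$ be the canonical arrow, determined by $m_j\circ d^0_j=\mathsf{Cyl}(j)$ and $m_j\circ d^1_j=i_0(a_1)$, and let $r_j:\mathsf{Cyl}(a_1)\to a_j$ be an arrow, provided by $j$ being a cofibration, with $r_j\circ\mathsf{Cyl}(j)=d^0_j$ and $r_j\circ i_0(a_1)=d^1_j$. Then $r_j$ is a strong deformation retraction of $m_j$ with respect to $\underline{\mathsf{Cyl}}$.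
   Context: Formal categories. Let $\mathcal C$ be a strict 2-category with a final object $1$. For an object $\mathcal A$ of $\mathcal C$, an object of $\mathcal A$ is a 1-arrow $1\to\mathcal A$ and an arrow of $\mathcal A$ is a 2-arrow between such; composition, commutative diagrams, pushouts and pullbacks in $\mathcal A$ are those of the category $\mathrm{Hom}_{\mathcal C}(1,\mathcal A)$. For 1-arrows $F,F_0,F_1:\mathcal A\to\mathcal A$, a 2-arrow $\eta:F_0\to F_1$, an object $a$ and an arrow $f$ of $\mathcal A$: $F(a)=F\circ a$, $F(f)$ is the whiskering of $F$ and $f$, $\eta(a):F_0(a)\to F_1(a)$ is the whiskering of $\eta$ and $a$; $F\cdot\eta$, $\eta\cdot F$ are whiskerings. Standing assumption: for all objects $\mathcal A_0,\mathcal A_1$ of $\mathcal C$ and objects $a$ of $\mathcal A_0$, evaluation at $a$ sends pushout (resp. pullback) squares of $\mathrm{Hom}_{\mathcal C}(\mathcal A_0,\mathcal A_1)$ to pushout (resp. pullback) squares of $\mathcal A_1$. (For $\mathcal C$ the 2-category of categories these are ordinary categories, functors and natural transformations.) $\mathcal A$ is a fixed object of $\mathcal C$. A cylinder in $\mathcal A$ is a 1-arrow $\mathsf{Cyl}:\mathcal A\to\mathcal A$ with 2-arrows $i_0,i_1:\mathrm{id}_{\mathcal A}\to\mathsf{Cyl}$. Contraction: $p:\mathsf{Cyl}\to\mathrm{id}_{\mathcal A}$ with $pi_0=pi_1=\mathrm{id}$. Involution: $v:\mathsf{Cyl}\to\mathsf{Cyl}$ with $vi_0=i_1$, $vi_1=i_0$.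 Subdivision: a 1-arrow $\mathsf S:\mathcal A\to\mathcal A$, 2-arrows $r_0,r_1:\mathsf{Cyl}\to\mathsf S$ with $r_0i_0=r_1i_1$ a pushout square of $i_0$ and $i_1$ in $\mathrm{Hom}_{\mathcal C}(\mathcal A,\mathcal A)$, and $s:\mathsf{Cyl}\to\mathsf S$ with $si_0=r_1i_0$, $si_1=r_0i_1$; compatible with $p$ if $\overline ps=p$, where $\overline p:\mathsf S\to\mathrm{id}_{\mathcal A}$ is the unique 2-arrow with $\overline pr_0=\overline pr_1=p$. Lower right connection: $\Gamma_{lr}:\mathsf{Cyl}^2\to\mathsf{Cyl}$ with $\Gamma_{lr}(i_1\cdot\mathsf{Cyl})=\Gamma_{lr}(\mathsf{Cyl}\cdot i_1)=\mathrm{id}$, $\Gamma_{lr}(i_0\cdot\mathsf{Cyl})=\Gamma_{lr}(\mathsf{Cyl}\cdot i_0)=i_0p$. Upper right connection: $\Gamma_{ur}:\mathsf{Cyl}^2\to\mathsf{Cyl}$ with $\Gamma_{ur}(i_0\cdot\mathsf{Cyl})=\mathrm{id}$, $\Gamma_{ur}(\mathsf{Cyl}\cdot i_1)=v$, $\Gamma_{ur}(\mathsf{Cyl}\cdot i_0)=\Gamma_{ur}(i_1\cdot\mathsf{Cyl})=i_0p$. $\Gamma_{lr},\Gamma_{ur}$ are compatible with $(\mathsf S,r_0,r_1,s)$ if $x(s\cdot\mathsf{Cyl})=p\cdot\mathsf{Cyl}$, where $x:\mathsf S\circ\mathsf{Cyl}\to\mathsf{Cyl}$ is the unique (canonical)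 2-arrow with $x(r_0\cdot\mathsf{Cyl})=\Gamma_{lr}$, $x(r_1\cdot\mathsf{Cyl})=\Gamma_{ur}$. Mapping cylinder of $f:a_0\to a_1$: an object $a_f$ with $d^0_f:\mathsf{Cyl}(a_0)\to a_f$, $d^1_f:a_1\to a_f$ such that $d^0_f\circ i_0(a_0)=d^1_f\circ f$ is a pushout square. $\mathsf{Cyl}$ preserves mapping cylinders if it carries each such square to a pushout square (with maps $\mathsf{Cyl}(i_0(a_0)),\mathsf{Cyl}(d^0_f),\mathsf{Cyl}(f),\mathsf{Cyl}(d^1_f)$). Cofibration with respect to $\underline{\mathsf{Cyl}}$: $j:a_0\to a_1$ such that for all $f:a_1\to a_2$, $h:\mathsf{Cyl}(a_0)\to a_2$ with $h\circ i_0(a_0)=f\circ j$ there is $k:\mathsf{Cyl}(a_1)\to a_2$ with $k\circ\mathsf{Cyl}(j)=h$, $k\circ i_0(a_1)=f$. For $m:b_0\to b_1$, an arrow $r:b_1\to b_0$ is a strong deformation retraction of $m$ with respect to $\underline{\mathsf{Cyl}}$ if $rm=\mathrm{id}(b_0)$ and there is an arrow $\sigma:\mathsf{Cyl}(b_1)\to b_1$ with $\sigma\circ i_0(b_1)=mr$, $\sigma\circ i_1(b_1)=\mathrm{id}(b_1)$ and $\sigma\circ\mathsf{Cyl}(m)=m\circ p(b_0)$. *)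

theory Defs
  imports Main
begin

section \<open>Strict 2-categories\<close>

text \<open>
  Composites are written in the order of composition of functions: \<open>G \<odot> F\<close> is the 1-arrow
  ``first \<open>F\<close>, then \<open>G\<close>'', \<open>\<beta> \<cdot> \<alpha>\<close> is the vertical composite ``first \<open>\<alpha>\<close>, then \<open>\<beta>\<close>'',
  and \<open>\<beta> \<star> \<alpha> : G \<odot> F \<rightarrow> G' \<odot> F'\<close> is the horizontal composite of \<open>\<alpha> : F \<rightarrow> F'\<close> and
  \<open>\<beta> : G \<rightarrow> G'\<close>. The operations are only meaningful on composable arrows.
\<close>

record ('o, 'm, 't) two_cat =
  obj :: "'o set"
  arr1 :: "'m set"
  dom1 :: "'m \<Rightarrow> 'o"
  cod1 :: "'m \<Rightarrow> 'o"
  id1 :: "'o \<Rightarrow> 'm"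
  comp1 :: "'m \<Rightarrow> 'm \<Rightarrow> 'm" (infixr "\<odot>\<index>" 75)
  arr2 :: "'t set"
  dom2 :: "'t \<Rightarrow> 'm"
  cod2 :: "'t \<Rightarrow> 'm"
  id2 :: "'m \<Rightarrow> 't"
  vcomp :: "'t \<Rightarrow> 't \<Rightarrow> 't" (infixr "\<cdot>\<index>" 70)
  hcomp :: "'t \<Rightarrow> 't \<Rightarrow> 't" (infixr "\<star>\<index>" 75)

definition hom1 :: "('o, 'm, 't, 'x) two_cat_scheme \<Rightarrow> 'o \<Rightarrow> 'o \<Rightarrow> 'm set" where
  "hom1 C X Y = {F \<in> arr1 C. dom1 C F = X \<and> cod1 C F = Y}"

definition hom2 :: "('o, 'm, 't, 'x) two_cat_scheme \<Rightarrow> 'm \<Rightarrow> 'm \<Rightarrow> 't set" where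
  "hom2 C F G = {\<alpha> \<in> arr2 C. dom2 C \<alpha> = F \<and> cod2 C \<alpha> = G}"

locale strict_2category =
  fixes C :: "('o, 'm, 't, 'x) two_cat_scheme" (structure)
  assumes dom1_obj: "F \<in> arr1 C \<Longrightarrow> dom1 C F \<in> obj C"
    and cod1_obj: "F \<in> arr1 C \<Longrightarrow> cod1 C F \<in> obj C"
    and id1_hom: "X \<in> obj C \<Longrightarrow> id1 C X \<in> hom1 C X X"
    and comp1_hom: "\<lbrakk>F \<in> hom1 C X Y; G \<in> hom1 C Y Z\<rbrakk> \<Longrightarrow> G \<odot> F \<in> hom1 C X Z"
    and comp1_assoc: "\<lbrakk>F \<in> hom1 C W X; G \<in> hom1 C X Y; H \<in> hom1 C Y Z\<rbrakk>
      \<Longrightarrow> (H \<odot> G) \<odot> F = H \<odot> (G \<odot> F)"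
    and comp1_id_left: "F \<in> hom1 C X Y \<Longrightarrow> id1 C Y \<odot> F = F"
    and comp1_id_right: "F \<in> hom1 C X Y \<Longrightarrow> F \<odot> id1 C X = F"
    and dom2_arr1: "\<alpha> \<in> arr2 C \<Longrightarrow> dom2 C \<alpha> \<in> arr1 C"
    and cod2_arr1: "\<alpha> \<in> arr2 C \<Longrightarrow> cod2 C \<alpha> \<in> arr1 C"
    and dom1_parallel: "\<alpha> \<in> arr2 C \<Longrightarrow> dom1 C (dom2 C \<alpha>) = dom1 C (cod2 C \<alpha>)"
    and cod1_parallel: "\<alpha> \<in> arr2 C \<Longrightarrow> cod1 C (dom2 C \<alpha>) = cod1 C (cod2 C \<alpha>)"
    and id2_hom: "F \<in> arr1 C \<Longrightarrow> id2 C F \<in> hom2 C F F"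
    and vcomp_hom: "\<lbrakk>\<alpha> \<in> hom2 C F G; \<beta> \<in> hom2 C G H\<rbrakk> \<Longrightarrow> \<beta> \<cdot> \<alpha> \<in> hom2 C F H"
    and vcomp_assoc: "\<lbrakk>\<alpha> \<in> hom2 C E F; \<beta> \<in> hom2 C F G; \<gamma> \<in> hom2 C G H\<rbrakk>
      \<Longrightarrow> (\<gamma> \<cdot> \<beta>) \<cdot> \<alpha> = \<gamma> \<cdot> (\<beta> \<cdot> \<alpha>)"
    and vcomp_id_left: "\<alpha> \<in> hom2 C F G \<Longrightarrow> id2 C G \<cdot> \<alpha> = \<alpha>"
    and vcomp_id_right: "\<alpha> \<in> hom2 C F G \<Longrightarrow> \<alpha> \<cdot> id2 C F = \<alpha>"
    and hcomp_hom: "\<lbrakk>F \<in> hom1 C X Y; G \<in> hom1 C Y Z; \<alpha> \<in> hom2 C F F'; \<beta> \<in> hom2 C G G'\<rbrakk>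
      \<Longrightarrow> \<beta> \<star> \<alpha> \<in> hom2 C (G \<odot> F) (G' \<odot> F')"
    and hcomp_assoc: "\<lbrakk>F \<in> hom1 C W X; G \<in> hom1 C X Y; H \<in> hom1 C Y Z;
        \<alpha> \<in> hom2 C F F'; \<beta> \<in> hom2 C G G'; \<gamma> \<in> hom2 C H H'\<rbrakk>
      \<Longrightarrow> (\<gamma> \<star> \<beta>) \<star> \<alpha> = \<gamma> \<star> (\<beta> \<star> \<alpha>)"
    and hcomp_id_left: "\<lbrakk>F \<in> hom1 C X Y; \<alpha> \<in> hom2 C F F'\<rbrakk> \<Longrightarrow> id2 C (id1 C Y) \<star> \<alpha> = \<alpha>"
    and hcomp_id_right: "\<lbrakk>F \<in> hom1 C X Y; \<alpha> \<in> hom2 C F F'\<rbrakk> \<Longrightarrow> \<alpha> \<star> id2 C (id1 C X) = \<alpha>"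
    and hcomp_id2: "\<lbrakk>F \<in> hom1 C X Y; G \<in> hom1 C Y Z\<rbrakk>
      \<Longrightarrow> id2 C G \<star> id2 C F = id2 C (G \<odot> F)"
    and interchange: "\<lbrakk>F \<in> hom1 C X Y; G \<in> hom1 C Y Z; \<alpha> \<in> hom2 C F F'; \<alpha>' \<in> hom2 C F' F'';
        \<beta> \<in> hom2 C G G'; \<beta>' \<in> hom2 C G' G''\<rbrakk>
      \<Longrightarrow> (\<beta>' \<cdot> \<beta>) \<star> (\<alpha>' \<cdot> \<alpha>) = (\<beta>' \<star> \<alpha>') \<cdot> (\<beta> \<star> \<alpha>)"

text \<open>
  Whiskerings. As objects and arrows of \<open>A\<close> are 1-arrows \<open>1 \<rightarrow> A\<close> and 2-arrows between them,
  \<open>F(a)\<close> is \<open>F \<odot> a\<close>, \<open>F(f)\<close> is \<open>F \<lhd> f\<close>, and \<open>\<eta>(a)\<close> is \<open>\<eta> \<rhd> a\<close>.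
\<close>

definition lwhisk :: "('o, 'm, 't, 'x) two_cat_scheme \<Rightarrow> 'm \<Rightarrow> 't \<Rightarrow> 't" (infixr "\<lhd>\<index>" 80) where
  "F \<lhd>\<^bsub>C\<^esub> \<eta> = id2 C F \<star>\<^bsub>C\<^esub> \<eta>"

definition rwhisk :: "('o, 'm, 't, 'x) two_cat_scheme \<Rightarrow> 't \<Rightarrow> 'm \<Rightarrow> 't" (infixl "\<rhd>\<index>" 80) where
  "\<eta> \<rhd>\<^bsub>C\<^esub> F = \<eta> \<star>\<^bsub>C\<^esub> id2 C F"

text \<open>Final in the 2-categorical sense: each \<open>Hom(X, T)\<close> is the category with one arrow.\<close>

definition final_object :: "('o, 'm, 't, 'x) two_cat_scheme \<Rightarrow> 'o \<Rightarrow> bool" where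
  "final_object C T \<longleftrightarrow> T \<in> obj C \<and>
     (\<forall>X\<in>obj C. \<exists>!F. F \<in> hom1 C X T) \<and>
     (\<forall>X\<in>obj C. \<forall>F\<in>hom1 C X T. \<forall>\<alpha>\<in>hom2 C F F. \<alpha> = id2 C F)"

text \<open>
  Squares \<open>u \<cdot> f = v \<cdot> g\<close> in the category \<open>Hom(X, Y)\<close>, with \<open>f : a \<rightarrow> b\<close>, \<open>g : a \<rightarrow> c\<close>,
  \<open>u : b \<rightarrow> d\<close>, \<open>v : c \<rightarrow> d\<close>.
\<close>

context
  fixes C :: "('o, 'm, 't, 'x) two_cat_scheme" (structure)
begin

definition pushout_square :: "'o \<Rightarrow> 'o \<Rightarrow> 't \<Rightarrow> 't \<Rightarrow> 't \<Rightarrow> 't \<Rightarrow> bool" where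
  "pushout_square X Y f g u v \<longleftrightarrow>
     (\<exists>a\<in>hom1 C X Y. \<exists>b\<in>hom1 C X Y. \<exists>c\<in>hom1 C X Y. \<exists>d\<in>hom1 C X Y.
        f \<in> hom2 C a b \<and> g \<in> hom2 C a c \<and> u \<in> hom2 C b d \<and> v \<in> hom2 C c d \<and>
        u \<cdot> f = v \<cdot> g \<and>
        (\<forall>t\<in>hom1 C X Y. \<forall>h\<in>hom2 C b t. \<forall>k\<in>hom2 C c t. h \<cdot> f = k \<cdot> g \<longrightarrow>
           (\<exists>!w. w \<in> hom2 C d t \<and> w \<cdot> u = h \<and> w \<cdot> v = k)))"

definition pullback_square :: "'o \<Rightarrow> 'o \<Rightarrow> 't \<Rightarrow> 't \<Rightarrow> 't \<Rightarrow> 't \<Rightarrow> bool" where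
  "pullback_square X Y f g u v \<longleftrightarrow>
     (\<exists>a\<in>hom1 C X Y. \<exists>b\<in>hom1 C X Y. \<exists>c\<in>hom1 C X Y. \<exists>d\<in>hom1 C X Y.
        f \<in> hom2 C a b \<and> g \<in> hom2 C a c \<and> u \<in> hom2 C b d \<and> v \<in> hom2 C c d \<and>
        u \<cdot> f = v \<cdot> g \<and>
        (\<forall>t\<in>hom1 C X Y. \<forall>h\<in>hom2 C t b. \<forall>k\<in>hom2 C t c. u \<cdot> h = v \<cdot> k \<longrightarrow>
           (\<exists>!w. w \<in> hom2 C t a \<and> f \<cdot> w = h \<and> g \<cdot> w = k)))"

end

text \<open>
  The ambient setting: a strict 2-category with a final object, written \<open>pt\<close>, such that
  evaluation at objects preserves pushout and pullback squares.
\<close>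

locale formal_category_setting = strict_2category C
  for C :: "('o, 'm, 't, 'x) two_cat_scheme" (structure) +
  fixes pt :: 'o
  assumes pt_final: "final_object C pt"
    and eval_pushout: "\<lbrakk>A0 \<in> obj C; A1 \<in> obj C; a \<in> hom1 C pt A0; pushout_square C A0 A1 f g u v\<rbrakk>
      \<Longrightarrow> pushout_square C pt A1 (f \<rhd> a) (g \<rhd> a) (u \<rhd> a) (v \<rhd> a)"
    and eval_pullback: "\<lbrakk>A0 \<in> obj C; A1 \<in> obj C; a \<in> hom1 C pt A0; pullback_square C A0 A1 f g u v\<rbrakk>
      \<Longrightarrow> pullback_square C pt A1 (f \<rhd> a) (g \<rhd> a) (u \<rhd> a) (v \<rhd> a)"


section \<open>Cylinders and structures upon them\<close>

context
  fixes C :: "('o, 'm, 't, 'x) two_cat_scheme" (structure)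
    and A :: 'o
    and Cyl :: 'm and i0 i1 :: 't
begin

definition cylinder :: bool where
  "cylinder \<longleftrightarrow> Cyl \<in> hom1 C A A \<and> i0 \<in> hom2 C (id1 C A) Cyl \<and> i1 \<in> hom2 C (id1 C A) Cyl"

definition contraction :: "'t \<Rightarrow> bool" where
  "contraction p \<longleftrightarrow> p \<in> hom2 C Cyl (id1 C A) \<and>
     p \<cdot> i0 = id2 C (id1 C A) \<and> p \<cdot> i1 = id2 C (id1 C A)"

definition involution :: "'t \<Rightarrow> bool" where
  "involution v \<longleftrightarrow> v \<in> hom2 C Cyl Cyl \<and> v \<cdot> i0 = i1 \<and> v \<cdot> i1 = i0"

definition subdivision :: "'m \<Rightarrow> 't \<Rightarrow> 't \<Rightarrow> 't \<Rightarrow> bool" where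
  "subdivision S r0 r1 s \<longleftrightarrow> S \<in> hom1 C A A \<and>
     r0 \<in> hom2 C Cyl S \<and> r1 \<in> hom2 C Cyl S \<and> pushout_square C A A i0 i1 r0 r1 \<and>
     s \<in> hom2 C Cyl S \<and> s \<cdot> i0 = r1 \<cdot> i0 \<and> s \<cdot> i1 = r0 \<cdot> i1"

text \<open>
  For a contraction \<open>p\<close> and a subdivision there is exactly one \<open>pbar\<close> as in the first two equations,
  by the universal property of the pushout.
\<close>

definition subdivision_compatible :: "'t \<Rightarrow> 'm \<Rightarrow> 't \<Rightarrow> 't \<Rightarrow> 't \<Rightarrow> bool" where
  "subdivision_compatible p S r0 r1 s \<longleftrightarrow>
     (\<exists>pbar\<in>hom2 C S (id1 C A). pbar \<cdot> r0 = p \<and> pbar \<cdot> r1 = p \<and> pbar \<cdot> s = p)"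

definition lower_right_connection :: "'t \<Rightarrow> 't \<Rightarrow> bool" where
  "lower_right_connection p \<Gamma> \<longleftrightarrow> \<Gamma> \<in> hom2 C (Cyl \<odot> Cyl) Cyl \<and>
     \<Gamma> \<cdot> (i1 \<rhd> Cyl) = id2 C Cyl \<and> \<Gamma> \<cdot> (Cyl \<lhd> i1) = id2 C Cyl \<and>
     \<Gamma> \<cdot> (i0 \<rhd> Cyl) = i0 \<cdot> p \<and> \<Gamma> \<cdot> (Cyl \<lhd> i0) = i0 \<cdot> p"

definition upper_right_connection :: "'t \<Rightarrow> 't \<Rightarrow> 't \<Rightarrow> bool" where
  "upper_right_connection p v \<Gamma> \<longleftrightarrow> \<Gamma> \<in> hom2 C (Cyl \<odot> Cyl) Cyl \<and>
     \<Gamma> \<cdot> (i0 \<rhd> Cyl) = id2 C Cyl \<and> \<Gamma> \<cdot> (Cyl \<lhd> i1) = v \<and>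
     \<Gamma> \<cdot> (Cyl \<lhd> i0) = i0 \<cdot> p \<and> \<Gamma> \<cdot> (i1 \<rhd> Cyl) = i0 \<cdot> p"

text \<open>
  The canonical 2-arrow \<open>x\<close> is required to exist; its uniqueness is not used as a hypothesis.
  If it is unique, which is the case when whiskering with \<open>Cyl\<close> preserves the pushout defining
  \<open>S\<close>, the condition is the equation \<open>x \<cdot> (s \<rhd> Cyl) = p \<rhd> Cyl\<close> for that \<open>x\<close>.
\<close>

definition connections_compatible :: "'t \<Rightarrow> 'm \<Rightarrow> 't \<Rightarrow> 't \<Rightarrow> 't \<Rightarrow> 't \<Rightarrow> 't \<Rightarrow> bool" where
  "connections_compatible p S r0 r1 s \<Gamma>lr \<Gamma>ur \<longleftrightarrow>
     (\<exists>x\<in>hom2 C (S \<odot> Cyl) Cyl.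
        x \<cdot> (r0 \<rhd> Cyl) = \<Gamma>lr \<and> x \<cdot> (r1 \<rhd> Cyl) = \<Gamma>ur \<and> x \<cdot> (s \<rhd> Cyl) = p \<rhd> Cyl)"

context
  fixes pt :: 'o
begin

definition mapping_cylinder :: "'m \<Rightarrow> 'm \<Rightarrow> 't \<Rightarrow> 'm \<Rightarrow> 't \<Rightarrow> 't \<Rightarrow> bool" where
  "mapping_cylinder a0 a1 f af d0 d1 \<longleftrightarrow>
     a0 \<in> hom1 C pt A \<and> a1 \<in> hom1 C pt A \<and> f \<in> hom2 C a0 a1 \<and>
     af \<in> hom1 C pt A \<and> d0 \<in> hom2 C (Cyl \<odot> a0) af \<and> d1 \<in> hom2 C a1 af \<and>
     pushout_square C pt A (i0 \<rhd> a0) f d0 d1"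

definition preserves_mapping_cylinders :: bool where
  "preserves_mapping_cylinders \<longleftrightarrow>
     (\<forall>a0 a1 f af d0 d1. mapping_cylinder a0 a1 f af d0 d1 \<longrightarrow>
        pushout_square C pt A (Cyl \<lhd> (i0 \<rhd> a0)) (Cyl \<lhd> f) (Cyl \<lhd> d0) (Cyl \<lhd> d1))"

definition cofibration :: "'m \<Rightarrow> 'm \<Rightarrow> 't \<Rightarrow> bool" where
  "cofibration a0 a1 j \<longleftrightarrow>
     a0 \<in> hom1 C pt A \<and> a1 \<in> hom1 C pt A \<and> j \<in> hom2 C a0 a1 \<and>
     (\<forall>a2\<in>hom1 C pt A. \<forall>f\<in>hom2 C a1 a2. \<forall>h\<in>hom2 C (Cyl \<odot> a0) a2.
        h \<cdot> (i0 \<rhd> a0) = f \<cdot> j \<longrightarrow>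
        (\<exists>k\<in>hom2 C (Cyl \<odot> a1) a2. k \<cdot> (Cyl \<lhd> j) = h \<and> k \<cdot> (i0 \<rhd> a1) = f))"

definition strong_deformation_retraction :: "'t \<Rightarrow> 'm \<Rightarrow> 'm \<Rightarrow> 't \<Rightarrow> 't \<Rightarrow> bool" where
  "strong_deformation_retraction p b0 b1 m r \<longleftrightarrow>
     b0 \<in> hom1 C pt A \<and> b1 \<in> hom1 C pt A \<and> m \<in> hom2 C b0 b1 \<and> r \<in> hom2 C b1 b0 \<and>
     r \<cdot> m = id2 C b0 \<and>
     (\<exists>\<sigma>\<in>hom2 C (Cyl \<odot> b1) b1.
        \<sigma> \<cdot> (i0 \<rhd> b1) = m \<cdot> r \<and> \<sigma> \<cdot> (i1 \<rhd> b1) = id2 C b1 \<and>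
        \<sigma> \<cdot> (Cyl \<lhd> m) = m \<cdot> (p \<rhd> b0))"

end

end

end

theory Submission
  imports Defs
begin

text \<open>
  Write \<open>I\<close> for the cylinder. Both \<open>mj \<cdot> rj\<close> and the identity are homotopies \<open>I(a1) \<rightarrow> I(a1)\<close>;
  they have the same start \<open>i0(a1)\<close>, since \<open>rj\<close> extends \<open>d1\<close>, and they agree on \<open>a0\<close>, since \<open>rj\<close>
  extends \<open>d0\<close>. The theorem therefore rests on a general principle,
  \<open>homotopy_between_homotopies\<close>: two homotopies \<open>K\<close> and \<open>K'\<close> out of \<open>I(a)\<close> with the same start are
  themselves homotopic, relative to that start and to everything on which they agree.

  Geometrically, \<open>K' \<cdot> \<Gamma>ur(a)\<close> is a square that shrinks \<open>K'\<close> to the constant homotopy at its start,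
  and \<open>K \<cdot> \<Gamma>lr(a)\<close> is a square that expands the constant homotopy at the start of \<open>K\<close> back to \<open>K\<close>.
  These constant homotopies coincide, so the squares can be put side by side: they glue to one arrow
  \<open>y : S(I(a)) \<rightarrow> b\<close>, and \<open>\<sigma> = y \<cdot> s(I(a))\<close> is the sought homotopy from \<open>K'\<close> to \<open>K\<close>. On an arrow
  \<open>g\<close> on which \<open>K\<close> and \<open>K'\<close> agree, \<open>y\<close> restricts to the common value composed with the canonical
  \<open>x : S \<odot> I \<rightarrow> I\<close>, and compatibility of the connections with the subdivision says precisely that
  \<open>x\<close> becomes constant after composing with \<open>s\<close>. On the start, both squares are constant, so \<open>y\<close>
  restricts to a constant on \<open>S(a)\<close>, and compatibility of \<open>s\<close> with \<open>p\<close> applies.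

  Finally, that \<open>\<sigma>\<close> is constant on \<open>mj\<close> is an equation between arrows out of \<open>I(aj)\<close>. As \<open>I(aj)\<close> is
  a pushout, it suffices to check it on \<open>I(d0)\<close> and \<open>I(d1)\<close>, where it reduces to the two relative
  statements just made.
\<close>

section \<open>Whiskering and pushouts in a strict 2-category\<close>

context strict_2category
begin

lemma hom2_cod_hom1: "\<lbrakk>\<alpha> \<in> hom2 C F G; F \<in> hom1 C X Y\<rbrakk> \<Longrightarrow> G \<in> hom1 C X Y"
  using cod2_arr1 dom1_parallel cod1_parallel by (fastforce simp: hom1_def hom2_def)

lemma id2_hom': "F \<in> hom1 C X Y \<Longrightarrow> id2 C F \<in> hom2 C F F"
  by (simp add: hom1_def id2_hom)

lemma hom1_objs: "F \<in> hom1 C X Y \<Longrightarrow> X \<in> obj C" "F \<in> hom1 C X Y \<Longrightarrow> Y \<in> obj C"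
  using dom1_obj cod1_obj by (auto simp: hom1_def)

lemma lwhisk_hom:
  "\<lbrakk>a \<in> hom1 C X Y; f \<in> hom2 C a b; F \<in> hom1 C Y Z\<rbrakk> \<Longrightarrow> F \<lhd> f \<in> hom2 C (F \<odot> a) (F \<odot> b)"
  unfolding lwhisk_def by (blast intro: hcomp_hom id2_hom')

lemma rwhisk_hom:
  "\<lbrakk>a \<in> hom1 C X Y; F \<in> hom1 C Y Z; \<eta> \<in> hom2 C F G\<rbrakk> \<Longrightarrow> \<eta> \<rhd> a \<in> hom2 C (F \<odot> a) (G \<odot> a)"
  unfolding rwhisk_def by (blast intro: hcomp_hom id2_hom')

lemma lwhisk_vcomp:
  assumes "a \<in> hom1 C X Y" "F \<in> hom1 C Y Z" "f \<in> hom2 C a b" "g \<in> hom2 C b c"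
  shows "F \<lhd> (g \<cdot> f) = (F \<lhd> g) \<cdot> (F \<lhd> f)"
  using interchange[OF assms id2_hom' id2_hom'] assms vcomp_id_left[OF id2_hom']
  unfolding lwhisk_def by simp

lemma rwhisk_vcomp:
  assumes "a \<in> hom1 C X Y" "F \<in> hom1 C Y Z" "\<eta> \<in> hom2 C F G" "\<theta> \<in> hom2 C G H"
  shows "(\<theta> \<cdot> \<eta>) \<rhd> a = (\<theta> \<rhd> a) \<cdot> (\<eta> \<rhd> a)"
  using interchange[OF assms(1,2) id2_hom' id2_hom' assms(3,4)] assms vcomp_id_left[OF id2_hom']
  unfolding rwhisk_def by simp

lemma rwhisk_id2: "\<lbrakk>a \<in> hom1 C X Y; F \<in> hom1 C Y Z\<rbrakk> \<Longrightarrow> id2 C F \<rhd> a = id2 C (F \<odot> a)"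
  unfolding rwhisk_def by (rule hcomp_id2)

lemma lwhisk_id1: "\<lbrakk>a \<in> hom1 C X Y; f \<in> hom2 C a b\<rbrakk> \<Longrightarrow> id1 C Y \<lhd> f = f"
  unfolding lwhisk_def by (rule hcomp_id_left)

lemma rwhisk_rwhisk:
  assumes "a \<in> hom1 C W X" "F \<in> hom1 C X Y" "G \<in> hom1 C Y Z" "\<eta> \<in> hom2 C G G'"
  shows "(\<eta> \<rhd> F) \<rhd> a = \<eta> \<rhd> (F \<odot> a)"
  using hcomp_assoc[OF assms(1,2,3) id2_hom' id2_hom' assms(4)] assms hcomp_id2
  unfolding rwhisk_def by simp

lemma lwhisk_rwhisk:
  assumes "a \<in> hom1 C W X" "F \<in> hom1 C X Y" "G \<in> hom1 C Y Z" "\<eta> \<in> hom2 C F F'"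
  shows "(G \<lhd> \<eta>) \<rhd> a = G \<lhd> (\<eta> \<rhd> a)"
  using hcomp_assoc[OF assms(1,2,3) id2_hom' assms(4) id2_hom'] assms
  unfolding rwhisk_def lwhisk_def by simp

lemma lwhisk_lwhisk:
  assumes "a \<in> hom1 C W X" "F \<in> hom1 C X Y" "G \<in> hom1 C Y Z" "f \<in> hom2 C a b"
  shows "(G \<odot> F) \<lhd> f = G \<lhd> (F \<lhd> f)"
  using hcomp_assoc[OF assms(1,2,3,4) id2_hom' id2_hom'] assms hcomp_id2
  unfolding lwhisk_def by simp

text \<open>Both sides are the horizontal composite \<open>\<eta> \<star> f\<close>, by the interchange law.\<close>

lemma naturality:
  assumes "a \<in> hom1 C X Y" "F \<in> hom1 C Y Z" "f \<in> hom2 C a b" "\<eta> \<in> hom2 C F G"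
  shows "(\<eta> \<rhd> b) \<cdot> (F \<lhd> f) = (G \<lhd> f) \<cdot> (\<eta> \<rhd> a)"
proof -
  have b: "b \<in> hom1 C X Y" and G: "G \<in> hom1 C Y Z"
    using assms hom2_cod_hom1 by blast+
  have "(\<eta> \<rhd> b) \<cdot> (F \<lhd> f) = \<eta> \<star> f"
    unfolding rwhisk_def lwhisk_def
    using interchange[OF assms(1,2,3) id2_hom'[OF b] id2_hom'[OF assms(2)] assms(4)] assms
    by (simp add: vcomp_id_left vcomp_id_right)
  also have "\<eta> \<star> f = (G \<lhd> f) \<cdot> (\<eta> \<rhd> a)"
    unfolding rwhisk_def lwhisk_def
    using interchange[OF assms(1,2) id2_hom'[OF assms(1)] assms(3,4) id2_hom'[OF G]] assms
    by (simp add: vcomp_id_left vcomp_id_right)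
  finally show ?thesis .
qed

lemma pushout_ext:
  assumes "pushout_square C X Y f g u v" "u \<in> hom2 C b d"
    and "w \<in> hom2 C d t" "w' \<in> hom2 C d t"
    and eq: "w \<cdot> u = w' \<cdot> u" "w \<cdot> v = w' \<cdot> v"
  shows "w = w'"
proof -
  obtain a b' c d' where sq: "d' \<in> hom1 C X Y" "f \<in> hom2 C a b'" "g \<in> hom2 C a c"
      "u \<in> hom2 C b' d'" "v \<in> hom2 C c d'" "u \<cdot> f = v \<cdot> g"
    and univ: "\<And>t h k. \<lbrakk>t \<in> hom1 C X Y; h \<in> hom2 C b' t; k \<in> hom2 C c t; h \<cdot> f = k \<cdot> g\<rbrakk>
           \<Longrightarrow> \<exists>!w. w \<in> hom2 C d' t \<and> w \<cdot> u = h \<and> w \<cdot> v = k"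
    using assms(1) unfolding pushout_square_def by blast
  have d: "d' = d" using assms(2) sq(4) by (simp add: hom2_def)
  have w: "w \<in> hom2 C d' t" "w' \<in> hom2 C d' t" using assms(3,4) d by simp_all
  have "(w \<cdot> u) \<cdot> f = (w \<cdot> v) \<cdot> g"
    using vcomp_assoc[OF sq(2,4) w(1)] vcomp_assoc[OF sq(3,5) w(1)] sq(6) by simp
  from univ[OF hom2_cod_hom1[OF w(1) sq(1)] vcomp_hom[OF sq(4) w(1)] vcomp_hom[OF sq(5) w(1)] this]
  show ?thesis using w eq by metis
qed

lemma pushout_fill:
  assumes "pushout_square C X Y f g u v" "u \<in> hom2 C b d" "v \<in> hom2 C c d"
    and "h \<in> hom2 C b t" "k \<in> hom2 C c t" "h \<cdot> f = k \<cdot> g"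
  obtains w where "w \<in> hom2 C d t" "w \<cdot> u = h" "w \<cdot> v = k"
proof -
  obtain a b' c' d' where sq: "b' \<in> hom1 C X Y" "u \<in> hom2 C b' d'" "v \<in> hom2 C c' d'"
    and univ: "\<And>t h k. \<lbrakk>t \<in> hom1 C X Y; h \<in> hom2 C b' t; k \<in> hom2 C c' t; h \<cdot> f = k \<cdot> g\<rbrakk>
           \<Longrightarrow> \<exists>!w. w \<in> hom2 C d' t \<and> w \<cdot> u = h \<and> w \<cdot> v = k"
    using assms(1) unfolding pushout_square_def by blast
  have eqs: "b' = b" "c' = c" "d' = d" using assms(2,3) sq(2,3) by (auto simp: hom2_def)
  have "t \<in> hom1 C X Y" using hom2_cod_hom1 assms(4) sq(1) eqs by blast
  from univ[OF this] assms eqs that show thesis by blast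
qed

end


section \<open>A homotopy between two homotopies with the same start\<close>

locale structured_cylinder = formal_category_setting C pt
  for C :: "('o, 'm, 't, 'x) two_cat_scheme" (structure) and pt :: 'o +
  fixes A :: 'o and Cyl S :: 'm and i0 i1 p v r0 r1 s \<Gamma>lr \<Gamma>ur :: 't
  assumes cyl: "cylinder C A Cyl i0 i1"
    and contr: "contraction C A Cyl i0 i1 p"
    and subdiv: "subdivision C A Cyl i0 i1 S r0 r1 s"
    and subdiv_compat: "subdivision_compatible C A p S r0 r1 s"
    and lr: "lower_right_connection C Cyl i0 i1 p \<Gamma>lr"
    and ur: "upper_right_connection C Cyl i0 i1 p v \<Gamma>ur"
    and conn_compat: "connections_compatible C Cyl p S r0 r1 s \<Gamma>lr \<Gamma>ur"
begin

lemma Cyl_hom: "Cyl \<in> hom1 C A A" and S_hom: "S \<in> hom1 C A A"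
  and i0_hom: "i0 \<in> hom2 C (id1 C A) Cyl" and i1_hom: "i1 \<in> hom2 C (id1 C A) Cyl"
  and p_hom: "p \<in> hom2 C Cyl (id1 C A)"
  and r0_hom: "r0 \<in> hom2 C Cyl S" and r1_hom: "r1 \<in> hom2 C Cyl S" and s_hom: "s \<in> hom2 C Cyl S"
  and lr_hom: "\<Gamma>lr \<in> hom2 C (Cyl \<odot> Cyl) Cyl" and ur_hom: "\<Gamma>ur \<in> hom2 C (Cyl \<odot> Cyl) Cyl"
  using cyl contr subdiv lr ur
  unfolding cylinder_def contraction_def subdivision_def
    lower_right_connection_def upper_right_connection_def by blast+

lemma A_obj: "A \<in> obj C"
  using hom1_objs Cyl_hom by blast

lemma id_hom: "id1 C A \<in> hom1 C A A"
  using A_obj by (rule id1_hom)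

lemma CylCyl_hom: "Cyl \<odot> Cyl \<in> hom1 C A A"
  using Cyl_hom Cyl_hom by (rule comp1_hom)

lemma ev_hom:
  assumes a: "a \<in> hom1 C pt A"
  shows "Cyl \<odot> a \<in> hom1 C pt A"
    and "i0 \<rhd> a \<in> hom2 C a (Cyl \<odot> a)" "i1 \<rhd> a \<in> hom2 C a (Cyl \<odot> a)"
    and "p \<rhd> a \<in> hom2 C (Cyl \<odot> a) a"
    and "r0 \<rhd> a \<in> hom2 C (Cyl \<odot> a) (S \<odot> a)" "r1 \<rhd> a \<in> hom2 C (Cyl \<odot> a) (S \<odot> a)"
    and "s \<rhd> a \<in> hom2 C (Cyl \<odot> a) (S \<odot> a)"
    and "\<Gamma>lr \<rhd> a \<in> hom2 C (Cyl \<odot> Cyl \<odot> a) (Cyl \<odot> a)"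
    and "\<Gamma>ur \<rhd> a \<in> hom2 C (Cyl \<odot> Cyl \<odot> a) (Cyl \<odot> a)"
  using comp1_hom[OF a Cyl_hom] rwhisk_hom[OF a id_hom i0_hom] rwhisk_hom[OF a id_hom i1_hom]
    rwhisk_hom[OF a Cyl_hom p_hom] rwhisk_hom[OF a Cyl_hom r0_hom]
    rwhisk_hom[OF a Cyl_hom r1_hom] rwhisk_hom[OF a Cyl_hom s_hom]
    rwhisk_hom[OF a CylCyl_hom lr_hom] rwhisk_hom[OF a CylCyl_hom ur_hom]
    comp1_id_left[OF a] comp1_assoc[OF a Cyl_hom Cyl_hom]
  by simp_all

lemma Cyl_map: "\<lbrakk>a \<in> hom1 C pt A; f \<in> hom2 C a b\<rbrakk> \<Longrightarrow> Cyl \<lhd> f \<in> hom2 C (Cyl \<odot> a) (Cyl \<odot> b)"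
  and S_map: "\<lbrakk>a \<in> hom1 C pt A; f \<in> hom2 C a b\<rbrakk> \<Longrightarrow> S \<lhd> f \<in> hom2 C (S \<odot> a) (S \<odot> b)"
  by (blast intro: lwhisk_hom Cyl_hom S_hom)+

lemma subdivision_pushout_at:
  assumes "a \<in> hom1 C pt A"
  shows "pushout_square C pt A (i0 \<rhd> a) (i1 \<rhd> a) (r0 \<rhd> a) (r1 \<rhd> a)"
  using eval_pushout[OF A_obj A_obj assms] subdiv by (simp add: subdivision_def)

lemma subdivision_at:
  assumes a: "a \<in> hom1 C pt A"
  shows "(s \<rhd> a) \<cdot> (i0 \<rhd> a) = (r1 \<rhd> a) \<cdot> (i0 \<rhd> a)"
    and "(s \<rhd> a) \<cdot> (i1 \<rhd> a) = (r0 \<rhd> a) \<cdot> (i1 \<rhd> a)"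
  using subdiv rwhisk_vcomp[OF a id_hom i0_hom s_hom] rwhisk_vcomp[OF a id_hom i0_hom r1_hom]
    rwhisk_vcomp[OF a id_hom i1_hom s_hom] rwhisk_vcomp[OF a id_hom i1_hom r0_hom]
  by (simp_all add: subdivision_def)

lemma lower_right_at:
  assumes a: "a \<in> hom1 C pt A"
  shows "(\<Gamma>lr \<rhd> a) \<cdot> (i1 \<rhd> (Cyl \<odot> a)) = id2 C (Cyl \<odot> a)"
    and "(\<Gamma>lr \<rhd> a) \<cdot> (i0 \<rhd> (Cyl \<odot> a)) = (i0 \<rhd> a) \<cdot> (p \<rhd> a)"
    and "(\<Gamma>lr \<rhd> a) \<cdot> (Cyl \<lhd> (i0 \<rhd> a)) = (i0 \<rhd> a) \<cdot> (p \<rhd> a)"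
proof -
  have e: "\<Gamma>lr \<cdot> (i1 \<rhd> Cyl) = id2 C Cyl" "\<Gamma>lr \<cdot> (i0 \<rhd> Cyl) = i0 \<cdot> p"
    "\<Gamma>lr \<cdot> (Cyl \<lhd> i0) = i0 \<cdot> p"
    using lr by (simp_all add: lower_right_connection_def)
  have h: "i1 \<rhd> Cyl \<in> hom2 C Cyl (Cyl \<odot> Cyl)" "i0 \<rhd> Cyl \<in> hom2 C Cyl (Cyl \<odot> Cyl)"
    "Cyl \<lhd> i0 \<in> hom2 C Cyl (Cyl \<odot> Cyl)"
    using rwhisk_hom[OF Cyl_hom id_hom i1_hom] rwhisk_hom[OF Cyl_hom id_hom i0_hom]
      lwhisk_hom[OF id_hom i0_hom Cyl_hom] comp1_id_left[OF Cyl_hom] comp1_id_right[OF Cyl_hom]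
    by simp_all
  note ev = rwhisk_vcomp[OF a Cyl_hom _ lr_hom]
  show "(\<Gamma>lr \<rhd> a) \<cdot> (i1 \<rhd> (Cyl \<odot> a)) = id2 C (Cyl \<odot> a)"
    using ev[OF h(1)] rwhisk_rwhisk[OF a Cyl_hom id_hom i1_hom] e(1) rwhisk_id2[OF a Cyl_hom]
    by simp
  show "(\<Gamma>lr \<rhd> a) \<cdot> (i0 \<rhd> (Cyl \<odot> a)) = (i0 \<rhd> a) \<cdot> (p \<rhd> a)"
    using ev[OF h(2)] rwhisk_rwhisk[OF a Cyl_hom id_hom i0_hom] e(2)
      rwhisk_vcomp[OF a Cyl_hom p_hom i0_hom] by simp
  show "(\<Gamma>lr \<rhd> a) \<cdot> (Cyl \<lhd> (i0 \<rhd> a)) = (i0 \<rhd> a) \<cdot> (p \<rhd> a)"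
    using ev[OF h(3)] lwhisk_rwhisk[OF a id_hom Cyl_hom i0_hom] e(3)
      rwhisk_vcomp[OF a Cyl_hom p_hom i0_hom] by simp
qed

lemma upper_right_at:
  assumes a: "a \<in> hom1 C pt A"
  shows "(\<Gamma>ur \<rhd> a) \<cdot> (i0 \<rhd> (Cyl \<odot> a)) = id2 C (Cyl \<odot> a)"
    and "(\<Gamma>ur \<rhd> a) \<cdot> (i1 \<rhd> (Cyl \<odot> a)) = (i0 \<rhd> a) \<cdot> (p \<rhd> a)"
    and "(\<Gamma>ur \<rhd> a) \<cdot> (Cyl \<lhd> (i0 \<rhd> a)) = (i0 \<rhd> a) \<cdot> (p \<rhd> a)"
proof -
  have e: "\<Gamma>ur \<cdot> (i0 \<rhd> Cyl) = id2 C Cyl" "\<Gamma>ur \<cdot> (i1 \<rhd> Cyl) = i0 \<cdot> p"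
    "\<Gamma>ur \<cdot> (Cyl \<lhd> i0) = i0 \<cdot> p"
    using ur by (simp_all add: upper_right_connection_def)
  have h: "i0 \<rhd> Cyl \<in> hom2 C Cyl (Cyl \<odot> Cyl)" "i1 \<rhd> Cyl \<in> hom2 C Cyl (Cyl \<odot> Cyl)"
    "Cyl \<lhd> i0 \<in> hom2 C Cyl (Cyl \<odot> Cyl)"
    using rwhisk_hom[OF Cyl_hom id_hom i1_hom] rwhisk_hom[OF Cyl_hom id_hom i0_hom]
      lwhisk_hom[OF id_hom i0_hom Cyl_hom] comp1_id_left[OF Cyl_hom] comp1_id_right[OF Cyl_hom]
    by simp_all
  note ev = rwhisk_vcomp[OF a Cyl_hom _ ur_hom]
  show "(\<Gamma>ur \<rhd> a) \<cdot> (i0 \<rhd> (Cyl \<odot> a)) = id2 C (Cyl \<odot> a)"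
    using ev[OF h(1)] rwhisk_rwhisk[OF a Cyl_hom id_hom i0_hom] e(1) rwhisk_id2[OF a Cyl_hom]
    by simp
  show "(\<Gamma>ur \<rhd> a) \<cdot> (i1 \<rhd> (Cyl \<odot> a)) = (i0 \<rhd> a) \<cdot> (p \<rhd> a)"
    using ev[OF h(2)] rwhisk_rwhisk[OF a Cyl_hom id_hom i1_hom] e(2)
      rwhisk_vcomp[OF a Cyl_hom p_hom i0_hom] by simp
  show "(\<Gamma>ur \<rhd> a) \<cdot> (Cyl \<lhd> (i0 \<rhd> a)) = (i0 \<rhd> a) \<cdot> (p \<rhd> a)"
    using ev[OF h(3)] lwhisk_rwhisk[OF a id_hom Cyl_hom i0_hom] e(3)
      rwhisk_vcomp[OF a Cyl_hom p_hom i0_hom] by simp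
qed

lemma connection_natural:
  assumes a: "a \<in> hom1 C pt A" and g: "g \<in> hom2 C a b"
    and G: "\<Gamma> \<in> hom2 C (Cyl \<odot> Cyl) Cyl"
  shows "(\<Gamma> \<rhd> b) \<cdot> (Cyl \<lhd> (Cyl \<lhd> g)) = (Cyl \<lhd> g) \<cdot> (\<Gamma> \<rhd> a)"
  using naturality[OF a CylCyl_hom g G] lwhisk_lwhisk[OF a Cyl_hom Cyl_hom g] by simp

lemma subdivision_collapse_at:
  assumes a: "a \<in> hom1 C pt A"
  obtains q where "q \<in> hom2 C (S \<odot> a) a" "q \<cdot> (r0 \<rhd> a) = p \<rhd> a" "q \<cdot> (r1 \<rhd> a) = p \<rhd> a"
    "q \<cdot> (s \<rhd> a) = p \<rhd> a"
proof -
  obtain pbar where P: "pbar \<in> hom2 C S (id1 C A)" "pbar \<cdot> r0 = p" "pbar \<cdot> r1 = p" "pbar \<cdot> s = p"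
    using subdiv_compat unfolding subdivision_compatible_def by blast
  show thesis
  proof (rule that)
    show "pbar \<rhd> a \<in> hom2 C (S \<odot> a) a"
      using rwhisk_hom[OF a S_hom P(1)] comp1_id_left[OF a] by simp
  qed (use rwhisk_vcomp[OF a Cyl_hom _ P(1)] r0_hom r1_hom s_hom P in metis)+
qed

text \<open>
  The arrow \<open>q\<close> is \<open>x(a)\<close>. Since \<open>(r0 \<rhd> Cyl) \<rhd> a = r0 \<rhd> (Cyl \<odot> a)\<close>, it is an arrow out of the
  subdivided cylinder on the object \<open>Cyl \<odot> a\<close>, where evaluation supplies a pushout square.
\<close>

lemma connections_glued_at:
  assumes a: "a \<in> hom1 C pt A"
  obtains q where "q \<in> hom2 C (S \<odot> Cyl \<odot> a) (Cyl \<odot> a)"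
    "q \<cdot> (r0 \<rhd> (Cyl \<odot> a)) = \<Gamma>lr \<rhd> a" "q \<cdot> (r1 \<rhd> (Cyl \<odot> a)) = \<Gamma>ur \<rhd> a"
    "q \<cdot> (s \<rhd> (Cyl \<odot> a)) = p \<rhd> (Cyl \<odot> a)"
proof -
  obtain x where X: "x \<in> hom2 C (S \<odot> Cyl) Cyl" "x \<cdot> (r0 \<rhd> Cyl) = \<Gamma>lr" "x \<cdot> (r1 \<rhd> Cyl) = \<Gamma>ur"
      "x \<cdot> (s \<rhd> Cyl) = p \<rhd> Cyl"
    using conn_compat unfolding connections_compatible_def by blast
  have ev: "(x \<rhd> a) \<cdot> (\<eta> \<rhd> (Cyl \<odot> a)) = (x \<cdot> (\<eta> \<rhd> Cyl)) \<rhd> a" if e: "\<eta> \<in> hom2 C Cyl S" for \<eta>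
    using rwhisk_vcomp[OF a CylCyl_hom rwhisk_hom[OF Cyl_hom Cyl_hom e] X(1)]
      rwhisk_rwhisk[OF a Cyl_hom Cyl_hom e] by simp
  show thesis
  proof (rule that)
    show "x \<rhd> a \<in> hom2 C (S \<odot> Cyl \<odot> a) (Cyl \<odot> a)"
      using rwhisk_hom[OF a comp1_hom[OF Cyl_hom S_hom] X(1)] comp1_assoc[OF a Cyl_hom S_hom]
      by simp
    show "(x \<rhd> a) \<cdot> (s \<rhd> (Cyl \<odot> a)) = p \<rhd> (Cyl \<odot> a)"
      using ev[OF s_hom] X(4) rwhisk_rwhisk[OF a Cyl_hom Cyl_hom p_hom] by simp
  qed (use ev r0_hom r1_hom X in metis)+
qed

text \<open>
  Equations between arrows out of \<open>S(c)\<close> can be checked on the two halves \<open>r0(c)\<close> and \<open>r1(c)\<close>, and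
  then hold along \<open>s(c)\<close>; naturality of \<open>r0\<close>, \<open>r1\<close> and \<open>s\<close> transports this along \<open>g\<close>. It is used
  with \<open>q\<close> equal to \<open>pbar(c)\<close> or to the glued connections, for both of which \<open>q \<cdot> s(c)\<close> is a
  component of \<open>p\<close>, so that the restricted homotopy \<open>y \<cdot> s(b)\<close> is constant along \<open>g\<close>.
\<close>

lemma subdivided_homotopy_restrict:
  assumes c: "c \<in> hom1 C pt A" and g: "g \<in> hom2 C c b"
    and y: "y \<in> hom2 C (S \<odot> b) t" and q: "q \<in> hom2 C (S \<odot> c) e" and k: "k \<in> hom2 C e t"
    and y0: "(y \<cdot> (r0 \<rhd> b)) \<cdot> (Cyl \<lhd> g) = k \<cdot> (q \<cdot> (r0 \<rhd> c))"
    and y1: "(y \<cdot> (r1 \<rhd> b)) \<cdot> (Cyl \<lhd> g) = k \<cdot> (q \<cdot> (r1 \<rhd> c))"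
  shows "(y \<cdot> (s \<rhd> b)) \<cdot> (Cyl \<lhd> g) = k \<cdot> (q \<cdot> (s \<rhd> c))"
proof -
  have b: "b \<in> hom1 C pt A" using hom2_cod_hom1[OF g c] .
  have move: "(y \<cdot> (\<eta> \<rhd> b)) \<cdot> (Cyl \<lhd> g) = (y \<cdot> (S \<lhd> g)) \<cdot> (\<eta> \<rhd> c)"
    and assoc: "(k \<cdot> q) \<cdot> (\<eta> \<rhd> c) = k \<cdot> (q \<cdot> (\<eta> \<rhd> c))" if e: "\<eta> \<in> hom2 C Cyl S" for \<eta>
    using vcomp_assoc[OF Cyl_map[OF c g] rwhisk_hom[OF b Cyl_hom e] y]
      vcomp_assoc[OF rwhisk_hom[OF c Cyl_hom e] S_map[OF c g] y]
      vcomp_assoc[OF rwhisk_hom[OF c Cyl_hom e] q k]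
      naturality[OF c Cyl_hom g e] by simp_all
  have "y \<cdot> (S \<lhd> g) = k \<cdot> q"
    by (rule pushout_ext[OF subdivision_pushout_at[OF c] ev_hom(5)[OF c]
          vcomp_hom[OF S_map[OF c g] y] vcomp_hom[OF q k]])
      (use move assoc r0_hom r1_hom y0 y1 in metis)+
  then show ?thesis using move[OF s_hom] assoc[OF s_hom] by simp
qed

text \<open>
  Homotopies with the same start can be deformed into each other by retreating along \<open>K'\<close> to the
  start and advancing again along \<open>K\<close>. In general this moves points that \<open>K\<close> and \<open>K'\<close> treat alike:
  along \<open>g\<close> it is a path followed backwards and then forwards. The compatibility of the connections
  with \<open>s\<close> cancels such a detour strictly, not only up to homotopy, which is what makes the last
  conclusion an equation. A single \<open>\<sigma>\<close> serves all \<open>g\<close>.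
\<close>

lemma homotopy_between_homotopies:
  assumes a: "a \<in> hom1 C pt A"
    and K: "K \<in> hom2 C (Cyl \<odot> a) b" and K': "K' \<in> hom2 C (Cyl \<odot> a) b"
    and start: "K \<cdot> (i0 \<rhd> a) = K' \<cdot> (i0 \<rhd> a)"
  obtains \<sigma> where "\<sigma> \<in> hom2 C (Cyl \<odot> Cyl \<odot> a) b"
    and "\<sigma> \<cdot> (i0 \<rhd> (Cyl \<odot> a)) = K'" and "\<sigma> \<cdot> (i1 \<rhd> (Cyl \<odot> a)) = K"
    and "\<sigma> \<cdot> (Cyl \<lhd> (i0 \<rhd> a)) = (K \<cdot> (i0 \<rhd> a)) \<cdot> (p \<rhd> a)"
    and "\<And>c g. \<lbrakk>c \<in> hom1 C pt A; g \<in> hom2 C c a; K \<cdot> (Cyl \<lhd> g) = K' \<cdot> (Cyl \<lhd> g)\<rbrakk>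
           \<Longrightarrow> \<sigma> \<cdot> (Cyl \<lhd> (Cyl \<lhd> g)) = (K \<cdot> (Cyl \<lhd> g)) \<cdot> (p \<rhd> (Cyl \<odot> c))"
proof -
  let ?Ia = "Cyl \<odot> a"
  note Ia = ev_hom(1)[OF a]
  note h = ev_hom[OF a] and hI = ev_hom[OF Ia]
  note i0a = Cyl_map[OF a h(2)]
  have lr_start: "(K \<cdot> (\<Gamma>lr \<rhd> a)) \<cdot> (i0 \<rhd> ?Ia) = (K \<cdot> (i0 \<rhd> a)) \<cdot> (p \<rhd> a)"
    and lr_end: "(K \<cdot> (\<Gamma>lr \<rhd> a)) \<cdot> (i1 \<rhd> ?Ia) = K"
    and lr_i0: "(K \<cdot> (\<Gamma>lr \<rhd> a)) \<cdot> (Cyl \<lhd> (i0 \<rhd> a)) = (K \<cdot> (i0 \<rhd> a)) \<cdot> (p \<rhd> a)"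
    using vcomp_assoc[OF hI(2) h(8) K] vcomp_assoc[OF hI(3) h(8) K] vcomp_assoc[OF i0a h(8) K]
      vcomp_assoc[OF h(4,2) K] vcomp_id_right[OF K] lower_right_at[OF a] by simp_all
  have ur_start: "(K' \<cdot> (\<Gamma>ur \<rhd> a)) \<cdot> (i0 \<rhd> ?Ia) = K'"
    and ur_end: "(K' \<cdot> (\<Gamma>ur \<rhd> a)) \<cdot> (i1 \<rhd> ?Ia) = (K' \<cdot> (i0 \<rhd> a)) \<cdot> (p \<rhd> a)"
    and ur_i0: "(K' \<cdot> (\<Gamma>ur \<rhd> a)) \<cdot> (Cyl \<lhd> (i0 \<rhd> a)) = (K' \<cdot> (i0 \<rhd> a)) \<cdot> (p \<rhd> a)"
    using vcomp_assoc[OF hI(2) h(9) K'] vcomp_assoc[OF hI(3) h(9) K'] vcomp_assoc[OF i0a h(9) K']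
      vcomp_assoc[OF h(4,2) K'] vcomp_id_right[OF K'] upper_right_at[OF a] by simp_all
  have "(K \<cdot> (\<Gamma>lr \<rhd> a)) \<cdot> (i0 \<rhd> ?Ia) = (K' \<cdot> (\<Gamma>ur \<rhd> a)) \<cdot> (i1 \<rhd> ?Ia)"
    using lr_start ur_end start by simp
  then obtain y where y: "y \<in> hom2 C (S \<odot> ?Ia) b"
    and yr0: "y \<cdot> (r0 \<rhd> ?Ia) = K \<cdot> (\<Gamma>lr \<rhd> a)" and yr1: "y \<cdot> (r1 \<rhd> ?Ia) = K' \<cdot> (\<Gamma>ur \<rhd> a)"
    using pushout_fill[OF subdivision_pushout_at[OF Ia] hI(5,6)
        vcomp_hom[OF h(8) K] vcomp_hom[OF h(9) K']] by blast
  \<comment> \<open>As \<open>s\<close> starts in \<open>r1\<close> and ends in \<open>r0\<close>, the homotopy starts in \<open>K'\<close> and ends in \<open>K\<close>.\<close>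
  show thesis
  proof (rule that)
    show "y \<cdot> (s \<rhd> ?Ia) \<in> hom2 C (Cyl \<odot> ?Ia) b"
      using vcomp_hom[OF hI(7) y] .
    show "(y \<cdot> (s \<rhd> ?Ia)) \<cdot> (i0 \<rhd> ?Ia) = K'"
      using vcomp_assoc[OF hI(2,7) y] vcomp_assoc[OF hI(2,6) y] subdivision_at(1)[OF Ia]
        yr1 ur_start by simp
    show "(y \<cdot> (s \<rhd> ?Ia)) \<cdot> (i1 \<rhd> ?Ia) = K"
      using vcomp_assoc[OF hI(3,7) y] vcomp_assoc[OF hI(3,5) y] subdivision_at(2)[OF Ia]
        yr0 lr_end by simp
    obtain q where q: "q \<in> hom2 C (S \<odot> a) a" "q \<cdot> (r0 \<rhd> a) = p \<rhd> a" "q \<cdot> (r1 \<rhd> a) = p \<rhd> a"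
      "q \<cdot> (s \<rhd> a) = p \<rhd> a"
      using subdivision_collapse_at[OF a] .
    show "(y \<cdot> (s \<rhd> ?Ia)) \<cdot> (Cyl \<lhd> (i0 \<rhd> a)) = (K \<cdot> (i0 \<rhd> a)) \<cdot> (p \<rhd> a)"
      using subdivided_homotopy_restrict[OF a h(2) y q(1) vcomp_hom[OF h(2) K]]
        yr0 yr1 lr_i0 ur_i0 start q by simp
  next
    fix c g
    assume c: "c \<in> hom1 C pt A" and g: "g \<in> hom2 C c a" and agree: "K \<cdot> (Cyl \<lhd> g) = K' \<cdot> (Cyl \<lhd> g)"
    note hc = ev_hom[OF c] and Ig = Cyl_map[OF c g]
    note IIg = Cyl_map[OF hc(1) Ig]
    obtain q where q: "q \<in> hom2 C (S \<odot> Cyl \<odot> c) (Cyl \<odot> c)"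
      "q \<cdot> (r0 \<rhd> (Cyl \<odot> c)) = \<Gamma>lr \<rhd> c" "q \<cdot> (r1 \<rhd> (Cyl \<odot> c)) = \<Gamma>ur \<rhd> c"
      "q \<cdot> (s \<rhd> (Cyl \<odot> c)) = p \<rhd> (Cyl \<odot> c)"
      using connections_glued_at[OF c] .
    have "(K \<cdot> (\<Gamma>lr \<rhd> a)) \<cdot> (Cyl \<lhd> (Cyl \<lhd> g)) = (K \<cdot> (Cyl \<lhd> g)) \<cdot> (\<Gamma>lr \<rhd> c)"
      using vcomp_assoc[OF IIg h(8) K] vcomp_assoc[OF hc(8) Ig K] connection_natural[OF c g lr_hom]
      by simp
    moreover have "(K' \<cdot> (\<Gamma>ur \<rhd> a)) \<cdot> (Cyl \<lhd> (Cyl \<lhd> g)) = (K \<cdot> (Cyl \<lhd> g)) \<cdot> (\<Gamma>ur \<rhd> c)"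
      using vcomp_assoc[OF IIg h(9) K'] vcomp_assoc[OF hc(9) Ig K'] connection_natural[OF c g ur_hom]
        agree by simp
    ultimately show
      "(y \<cdot> (s \<rhd> ?Ia)) \<cdot> (Cyl \<lhd> (Cyl \<lhd> g)) = (K \<cdot> (Cyl \<lhd> g)) \<cdot> (p \<rhd> (Cyl \<odot> c))"
      using subdivided_homotopy_restrict[OF hc(1) Ig y q(1) vcomp_hom[OF Ig K]] yr0 yr1 q by simp
  qed
qed

end


section \<open>The strong deformation retraction\<close>

theorem mainTheorem12:
  fixes C :: "('o, 'm, 't, 'x) two_cat_scheme" (structure)
    and pt A :: 'o
    and Cyl S :: 'm
    and i0 i1 p v r0 r1 s \<Gamma>lr \<Gamma>ur :: 't
    and a0 a1 aj :: 'm
    and j d0 d1 mj rj :: 't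
  assumes "formal_category_setting C pt"
    and "A \<in> obj C"
    and "cylinder C A Cyl i0 i1"
    and "contraction C A Cyl i0 i1 p"
    and "involution C Cyl i0 i1 v"
    and "subdivision C A Cyl i0 i1 S r0 r1 s"
    and "subdivision_compatible C A p S r0 r1 s"
    and "lower_right_connection C Cyl i0 i1 p \<Gamma>lr"
    and "upper_right_connection C Cyl i0 i1 p v \<Gamma>ur"
    and "connections_compatible C Cyl p S r0 r1 s \<Gamma>lr \<Gamma>ur"
    and "preserves_mapping_cylinders C A Cyl i0 pt"
    and "cofibration C A Cyl i0 pt a0 a1 j"
    and "mapping_cylinder C A Cyl i0 pt a0 a1 j aj d0 d1"
    and "mj \<in> hom2 C aj (Cyl \<odot> a1)"
    and "mj \<cdot> d0 = Cyl \<lhd> j"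
    and "mj \<cdot> d1 = i0 \<rhd> a1"
    and "rj \<in> hom2 C (Cyl \<odot> a1) aj"
    and "rj \<cdot> (Cyl \<lhd> j) = d0"
    and "rj \<cdot> (i0 \<rhd> a1) = d1"
  shows "strong_deformation_retraction C A Cyl i0 i1 pt p aj (Cyl \<odot> a1) mj rj"
proof -
  interpret structured_cylinder C pt A Cyl S i0 i1 p v r0 r1 s \<Gamma>lr \<Gamma>ur
    using assms(1,3,4,6-10) by (simp add: structured_cylinder_def structured_cylinder_axioms_def)
  note j_cyl = assms(13)[unfolded mapping_cylinder_def]
  have a0: "a0 \<in> hom1 C pt A" and a1: "a1 \<in> hom1 C pt A" and j: "j \<in> hom2 C a0 a1"
    and aj: "aj \<in> hom1 C pt A" and d0: "d0 \<in> hom2 C (Cyl \<odot> a0) aj" and d1: "d1 \<in> hom2 C a1 aj"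
    and po: "pushout_square C pt A (i0 \<rhd> a0) j d0 d1"
    using j_cyl by blast+
  have po': "pushout_square C pt A (Cyl \<lhd> (i0 \<rhd> a0)) (Cyl \<lhd> j) (Cyl \<lhd> d0) (Cyl \<lhd> d1)"
    using assms(11,13) unfolding preserves_mapping_cylinders_def by blast
  note m = assms(14) and r = assms(17)
  note h0 = ev_hom[OF a0] and h1 = ev_hom[OF a1] and hj = ev_hom[OF aj]
  note Ij = Cyl_map[OF a0 j] and Id0 = Cyl_map[OF h0(1) d0] and Id1 = Cyl_map[OF a1 d1]
  note Im = Cyl_map[OF aj m]
  have mr: "mj \<cdot> rj \<in> hom2 C (Cyl \<odot> a1) (Cyl \<odot> a1)"
    using vcomp_hom[OF r m] .
  have id: "id2 C (Cyl \<odot> a1) \<in> hom2 C (Cyl \<odot> a1) (Cyl \<odot> a1)"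
    using id2_hom'[OF h1(1)] .

  have retract: "rj \<cdot> mj = id2 C aj"
  proof (rule pushout_ext[OF po d0 vcomp_hom[OF m r] id2_hom'[OF aj]])
    show "(rj \<cdot> mj) \<cdot> d0 = id2 C aj \<cdot> d0"
      using vcomp_assoc[OF d0 m r] assms(15,18) vcomp_id_left[OF d0] by simp
    show "(rj \<cdot> mj) \<cdot> d1 = id2 C aj \<cdot> d1"
      using vcomp_assoc[OF d1 m r] assms(16,19) vcomp_id_left[OF d1] by simp
  qed

  \<comment> \<open>The homotopies \<open>K = id\<close> and \<open>K' = mj \<cdot> rj\<close> have the same start and agree along \<open>j\<close>.\<close>
  have start: "id2 C (Cyl \<odot> a1) \<cdot> (i0 \<rhd> a1) = (mj \<cdot> rj) \<cdot> (i0 \<rhd> a1)"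
    using vcomp_assoc[OF h1(2) r m] assms(16,19) vcomp_id_left[OF h1(2)] by simp
  have agree: "id2 C (Cyl \<odot> a1) \<cdot> (Cyl \<lhd> j) = (mj \<cdot> rj) \<cdot> (Cyl \<lhd> j)"
    using vcomp_assoc[OF Ij r m] assms(15,18) vcomp_id_left[OF Ij] by simp
  obtain \<sigma> where \<sigma>: "\<sigma> \<in> hom2 C (Cyl \<odot> Cyl \<odot> a1) (Cyl \<odot> a1)"
    and \<sigma>0: "\<sigma> \<cdot> (i0 \<rhd> (Cyl \<odot> a1)) = mj \<cdot> rj"
    and \<sigma>1: "\<sigma> \<cdot> (i1 \<rhd> (Cyl \<odot> a1)) = id2 C (Cyl \<odot> a1)"
    and \<sigma>_start: "\<sigma> \<cdot> (Cyl \<lhd> (i0 \<rhd> a1)) = (i0 \<rhd> a1) \<cdot> (p \<rhd> a1)"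
    and \<sigma>_agree: "\<sigma> \<cdot> (Cyl \<lhd> (Cyl \<lhd> j)) = (Cyl \<lhd> j) \<cdot> (p \<rhd> (Cyl \<odot> a0))"
    using homotopy_between_homotopies[OF a1 id mr start] a0 j agree
      vcomp_id_left[OF h1(2)] vcomp_id_left[OF Ij] by metis

  have p_natural: "(p \<rhd> aj) \<cdot> (Cyl \<lhd> d) = d \<cdot> (p \<rhd> c)"
    if "c \<in> hom1 C pt A" "d \<in> hom2 C c aj" for c d
    using naturality[OF that(1) Cyl_hom that(2) p_hom] lwhisk_id1[OF that] by simp
  have "\<sigma> \<cdot> (Cyl \<lhd> mj) = mj \<cdot> (p \<rhd> aj)"
  proof (rule pushout_ext[OF po' Id0 vcomp_hom[OF Im \<sigma>] vcomp_hom[OF hj(4) m]])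
    have "(\<sigma> \<cdot> (Cyl \<lhd> mj)) \<cdot> (Cyl \<lhd> d0) = \<sigma> \<cdot> (Cyl \<lhd> (Cyl \<lhd> j))"
      using vcomp_assoc[OF Id0 Im \<sigma>] lwhisk_vcomp[OF h0(1) Cyl_hom d0 m] assms(15) by simp
    also have "\<dots> = (mj \<cdot> d0) \<cdot> (p \<rhd> (Cyl \<odot> a0))"
      using \<sigma>_agree assms(15) by simp
    also have "\<dots> = (mj \<cdot> (p \<rhd> aj)) \<cdot> (Cyl \<lhd> d0)"
      using vcomp_assoc[OF ev_hom(4)[OF h0(1)] d0 m] vcomp_assoc[OF Id0 hj(4) m]
        p_natural[OF h0(1) d0] by simp
    finally show "(\<sigma> \<cdot> (Cyl \<lhd> mj)) \<cdot> (Cyl \<lhd> d0) = (mj \<cdot> (p \<rhd> aj)) \<cdot> (Cyl \<lhd> d0)" .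
    have "(\<sigma> \<cdot> (Cyl \<lhd> mj)) \<cdot> (Cyl \<lhd> d1) = \<sigma> \<cdot> (Cyl \<lhd> (i0 \<rhd> a1))"
      using vcomp_assoc[OF Id1 Im \<sigma>] lwhisk_vcomp[OF a1 Cyl_hom d1 m] assms(16) by simp
    also have "\<dots> = (mj \<cdot> d1) \<cdot> (p \<rhd> a1)"
      using \<sigma>_start assms(16) by simp
    also have "\<dots> = (mj \<cdot> (p \<rhd> aj)) \<cdot> (Cyl \<lhd> d1)"
      using vcomp_assoc[OF h1(4) d1 m] vcomp_assoc[OF Id1 hj(4) m] p_natural[OF a1 d1] by simp
    finally show "(\<sigma> \<cdot> (Cyl \<lhd> mj)) \<cdot> (Cyl \<lhd> d1) = (mj \<cdot> (p \<rhd> aj)) \<cdot> (Cyl \<lhd> d1)" .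
  qed
  then show ?thesis
    unfolding strong_deformation_retraction_def
    using aj h1(1) m r retract \<sigma> \<sigma>0 \<sigma>1 by blast
qed

end
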